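(* Let $\alpha>0$, $\alpha\neq 1$, and let $X,Y,Z$ be three discrete random variables with joint distribution $\mathcal{P}_{XYZ}$. Then $$I^Z_\alpha(X,Y|Z)=\frac{\alpha}{\alpha-1}\log\sum_z \mathcal{P}_Z(z)\left(\sum_{x,y}\mathcal{P}_{XY|Z=z}(x,y)^\alpha\left(\mathcal{P}_{X|Z=z}(x)\,\mathcal{P}_{Y|Z=z}(y)\right)^{1-\alpha}\right)^{\frac{1}{\alpha}}.$$
   Context: Rényi divergence: for $\alpha>0$, $\alpha\neq 1$, and probability measures $\mathcal{P},\mathcal{Q}$ with densities $p,q$ with respect to a common dominating measure $\mu$, $D_\alpha(\mathcal{P}\|\mathcal{Q})=\frac{1}{\alpha-1}\log\int p^\alpha q^{1-\alpha}\,d\mu$ ($=+\infty$ if $\alpha>1$ and $\mathcal{P}\not\ll\mathcal{Q}$). $\log$ is the natural logarithm. Definition: $I^{Z}_\alpha(X,Y|Z)=\min_{\mathcal{Q}_{Z}} D_\alpha(\mathcal{P}_{XYZ}\|\mathcal{P}_{X|Z}\mathcal{P}_{Y|Z}\mathcal{Q}_Z)$, where the minimum is over all probability distributions $\mathcal{Q}_Z$ on the alphabet of $Z$, and $\mathcal{P}_{X|Z}\mathcal{P}_{Y|Z}\mathcal{Q}_Z$ is the law under which $Z\sim\mathcal{Q}_Z$ and, given $Z$, $X$ and $Y$ are independent with conditional laws $\mathcal{P}_{X|Z}$ and $\mathcal{P}_{Y|Z}$ (the conditionals induced by $\mathcal{P}_{XYZ}$). The outer sum is over $z$ with $\mathcal{P}_Z(z)>0$,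 and in the inner sum terms with $\mathcal{P}_{XY|Z=z}(x,y)=0$ are taken to be $0$. *)

theory Defs
  imports "HOL-Probability.Probability"
begin

(* Logarithm and powers with values at 0 and infinity. The library's "ln" and "powr" are real-valued;
   here ln 0 = -infinity and ln infinity = infinity are needed. The power is only used
   with positive exponents, for which top is the right value at top. *)

definition ln_ext :: "ennreal \<Rightarrow> ereal" where
  "ln_ext x = (if x = 0 then -\<infinity> else if x = top then \<infinity> else ereal (ln (enn2real x)))"

definition powr_ext :: "ennreal \<Rightarrow> real \<Rightarrow> ennreal" where
  "powr_ext x r = (if x = top then top else ennreal (enn2real x powr r))"

(* p and q are the densities with respect to the dominating measure \<mu>. Since 0 powr r = 0,
   the points with p = 0 contribute nothing to the integral. For \<alpha> < 1 neither do those with q = 0;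
   for \<alpha> > 1 and p > 0 = q the integrand would have to be infinite, which is the case of a failure of
   absolute continuity, or else concerns a null set only. Mutually singular measures with \<alpha> < 1
   give (negative) * (-infinity) = infinity. *)

definition renyi_divergence ::
    "real \<Rightarrow> 'a measure \<Rightarrow> ('a \<Rightarrow> real) \<Rightarrow> ('a \<Rightarrow> real) \<Rightarrow> ereal" where
  "renyi_divergence \<alpha> \<mu> p q =
     (if \<alpha> > 1 \<and> \<not> absolutely_continuous (density \<mu> q) (density \<mu> p) then \<infinity>
      else ereal (1 / (\<alpha> - 1)) *
           ln_ext (\<integral>\<^sup>+ x. ennreal (p x powr \<alpha> * q x powr (1 - \<alpha>)) \<partial>\<mu>))"

(* Discrete distributions: the dominating measure is the counting measure,
   see measure_pmf_eq_density. *)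

definition renyi_divergence_pmf :: "real \<Rightarrow> 'a pmf \<Rightarrow> 'a pmf \<Rightarrow> ereal" where
  "renyi_divergence_pmf \<alpha> P Q = renyi_divergence \<alpha> (count_space UNIV) (pmf P) (pmf Q)"

definition marginal_Z :: "('x \<times> 'y \<times> 'z) pmf \<Rightarrow> 'z pmf" where
  "marginal_Z P = map_pmf (\<lambda>(x, y, z). z) P"

(* For z outside the support of the Z-marginal, cond_pmf is an unspecified distribution;
   neither side of the main result depends on it. *)

definition cond_XY :: "('x \<times> 'y \<times> 'z) pmf \<Rightarrow> 'z \<Rightarrow> ('x \<times> 'y) pmf" where
  "cond_XY P z = map_pmf (\<lambda>(x, y, z'). (x, y)) (cond_pmf P {(x, y, z'). z' = z})"

definition cond_X :: "('x \<times> 'y \<times> 'z) pmf \<Rightarrow> 'z \<Rightarrow> 'x pmf" where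
  "cond_X P z = map_pmf fst (cond_XY P z)"

definition cond_Y :: "('x \<times> 'y \<times> 'z) pmf \<Rightarrow> 'z \<Rightarrow> 'y pmf" where
  "cond_Y P z = map_pmf snd (cond_XY P z)"

definition cond_indep_law :: "('x \<times> 'y \<times> 'z) pmf \<Rightarrow> 'z pmf \<Rightarrow> ('x \<times> 'y \<times> 'z) pmf" where
  "cond_indep_law P Q =
     bind_pmf Q (\<lambda>z. map_pmf (\<lambda>(x, y). (x, y, z)) (pair_pmf (cond_X P z) (cond_Y P z)))"

(* An infimum; that it is a minimum is part of the main statement. *)

definition renyi_cond_mutual_info :: "real \<Rightarrow> ('x \<times> 'y \<times> 'z) pmf \<Rightarrow> ereal" where
  "renyi_cond_mutual_info \<alpha> P = (INF Q. renyi_divergence_pmf \<alpha> P (cond_indep_law P Q))"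

end

theory Submission
  imports Defs
begin

text \<open>
  Write \<open>p\<close> for the law of \<open>Z\<close> and \<open>W z\<close> for the inner sum. Summing over \<open>x\<close> and \<open>y\<close> first, the
  Renyi divergence of the candidate \<open>Q\<close> is the logarithm of \<open>T Q = (\<Sum>z. p z powr \<alpha> * Q z powr (1 - \<alpha>) * W z)\<close>,
  up to the factor \<open>1 / (\<alpha> - 1)\<close>. Let \<open>S = (\<Sum>z. p z * W z powr (1 / \<alpha>))\<close>. If \<open>S\<close> is finite,
  \<open>Q' z = p z * W z powr (1 / \<alpha>) / S\<close> is a distribution and Sibson's identity
  \<open>T Q = S powr \<alpha> * (\<Sum>z. Q' z powr \<alpha> * Q z powr (1 - \<alpha>))\<close> holds, so that \<open>Q'\<close> is optimal by the
  nonnegativity of the Renyi divergence of \<open>Q'\<close> from \<open>Q\<close>. If \<open>S\<close> is infinite, then \<open>\<alpha> > 1\<close>, and Young's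
  inequality, summed over \<open>z\<close>, shows that \<open>T Q\<close> is infinite for every \<open>Q\<close> whose support contains that of \<open>p\<close>.
\<close>

section \<open>Weighted AM-GM inequalities and Hellinger sums of two distributions\<close>

lemma powr_mult_powr_le:
  fixes a b r :: real
  assumes "0 < r" "r < 1" "0 \<le> a" "0 \<le> b"
  shows "a powr r * b powr (1 - r) \<le> r * a + (1 - r) * b"
proof (cases "a = 0 \<or> b = 0")
  case False
  then show ?thesis
    using Youngs_inequality_0[of r "1 - r" a b] assms by auto
qed (use assms in auto)

text \<open>Here \<open>a\<close> is the geometric mean of
  \<open>c = a powr r * b powr (1 - r)\<close> and \<open>b\<close> with weights 1/r and 1 - 1/r, so
  the previous lemma applies with exponent 1/r. The condition on \<open>b\<close> excludes a > 0 =
  b, where \<open>0 powr (1 - r) = 0\<close> would make the right side 0.\<close>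

lemma powr_mult_powr_ge:
  fixes a b r :: real
  assumes "1 < r" "0 \<le> a" "0 \<le> b" "a > 0 \<Longrightarrow> b > 0"
  shows "r * a \<le> a powr r * b powr (1 - r) + (r - 1) * b"
proof (cases "a = 0")
  case False
  with assms have a: "a > 0" and b: "b > 0" by auto
  define c where "c = a powr r * b powr (1 - r)"
  have "c powr (1 / r) = a * b powr ((1 - r) / r)"
    using a b assms by (simp add: c_def powr_mult powr_powr)
  then have "c powr (1 / r) * b powr (1 - 1 / r) = a * b powr ((1 - r) / r + (1 - 1 / r))"
    using b by (simp add: powr_add)
  also have "(1 - r) / r + (1 - 1 / r) = 0"
    using assms by (simp add: field_simps)
  finally have "a = c powr (1 / r) * b powr (1 - 1 / r)"
    using b by simp
  also have "\<dots> \<le> 1 / r * c + (1 - 1 / r) * b"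
    using a b assms by (intro powr_mult_powr_le) (auto simp: c_def)
  finally have "r * a \<le> r * (1 / r * c + (1 - 1 / r) * b)"
    using assms by (intro mult_left_mono) auto
  also have "\<dots> = c + (r - 1) * b"
    using assms by (simp add: field_simps)
  finally show ?thesis
    by (simp add: c_def)
qed (use assms in auto)

lemma nn_integral_pmf_UNIV: "(\<integral>\<^sup>+ x. ennreal (pmf p x) \<partial>count_space UNIV) = 1"
  by (simp add: nn_integral_pmf measure_pmf.emeasure_space_1[simplified])

text \<open>Nonnegativity of the Renyi divergence for orders below 1, where the factor in front of
  the logarithm is negative. The pointwise bounds add up to r + (1 - r).\<close>

lemma hellinger_sum_le_1:
  assumes "0 < r" "r < 1"
  shows "(\<integral>\<^sup>+ x. ennreal (pmf A x powr r * pmf B x powr (1 - r)) \<partial>count_space UNIV) \<le> 1"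
proof -
  have "(\<integral>\<^sup>+ x. ennreal (pmf A x powr r * pmf B x powr (1 - r)) \<partial>count_space UNIV)
      \<le> (\<integral>\<^sup>+ x. ennreal r * ennreal (pmf A x) + ennreal (1 - r) * ennreal (pmf B x) \<partial>count_space UNIV)"
    using assms powr_mult_powr_le[OF assms]
    by (intro nn_integral_mono) (simp flip: ennreal_mult ennreal_plus)
  also have "\<dots> = ennreal r + ennreal (1 - r)"
    by (simp add: nn_integral_add nn_integral_cmult nn_integral_pmf_UNIV)
  also have "\<dots> = 1"
    using assms by (simp flip: ennreal_plus)
  finally show ?thesis .
qed

text \<open>The function \<open>f\<close> is not normalised and may have infinite total mass. This
  serves both the Hellinger bound for orders above 1 and the case of an infinite \<open>S\<close>
  below.\<close>

lemma nn_integral_powr_mult_pmf_powr_ge: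
  fixes f :: "'a \<Rightarrow> real"
  assumes "1 < r" "\<And>x. 0 \<le> f x" "\<And>x. f x > 0 \<Longrightarrow> x \<in> set_pmf B"
  shows "ennreal r * (\<integral>\<^sup>+ x. ennreal (f x) \<partial>count_space UNIV)
    \<le> (\<integral>\<^sup>+ x. ennreal (f x powr r * pmf B x powr (1 - r)) \<partial>count_space UNIV) + ennreal (r - 1)"
proof -
  have "ennreal r * (\<integral>\<^sup>+ x. ennreal (f x) \<partial>count_space UNIV)
      = (\<integral>\<^sup>+ x. ennreal r * ennreal (f x) \<partial>count_space UNIV)"
    by (simp add: nn_integral_cmult)
  also have "\<dots> \<le> (\<integral>\<^sup>+ x. ennreal (f x powr r * pmf B x powr (1 - r))
      + ennreal (r - 1) * ennreal (pmf B x) \<partial>count_space UNIV)"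
    using assms powr_mult_powr_ge[OF assms(1)]
    by (intro nn_integral_mono) (simp add: pmf_positive flip: ennreal_mult ennreal_plus)
  also have "\<dots> = (\<integral>\<^sup>+ x. ennreal (f x powr r * pmf B x powr (1 - r)) \<partial>count_space UNIV)
      + ennreal (r - 1)"
    by (simp add: nn_integral_add nn_integral_cmult nn_integral_pmf_UNIV)
  finally show ?thesis .
qed

lemma hellinger_sum_ge_1:
  assumes "1 < r" "set_pmf A \<subseteq> set_pmf B"
  shows "1 \<le> (\<integral>\<^sup>+ x. ennreal (pmf A x powr r * pmf B x powr (1 - r)) \<partial>count_space UNIV)"
    (is "1 \<le> ?H")
proof (cases "?H = top")
  case False
  have "ennreal r \<le> ?H + ennreal (r - 1)"
    using nn_integral_powr_mult_pmf_powr_ge[of r "pmf A" B] assms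
    by (auto simp: nn_integral_pmf_UNIV pmf_positive_iff)
  with False assms(1) show ?thesis
    by (cases ?H) (auto simp flip: ennreal_plus)
qed simp

section \<open>Extended logarithms, powers and sums\<close>

lemma ln_ext_mono: "x \<le> y \<Longrightarrow> ln_ext x \<le> ln_ext y"
  by (cases x; cases y) (auto simp: ln_ext_def top_unique)

lemma ln_ext_powr: "s > 0 \<Longrightarrow> ln_ext (ennreal (s powr r)) = ereal (r * ln s)"
  by (simp add: ln_ext_def ln_powr)

lemma powr_ext_eq_0_iff: "powr_ext x r = 0 \<longleftrightarrow> x = 0"
  by (auto simp: powr_ext_def enn2real_eq_0_iff)

lemma powr_ext_le_1: "x \<le> 1 \<Longrightarrow> r \<ge> 0 \<Longrightarrow> powr_ext x r \<le> 1"
  by (cases x) (auto simp: powr_ext_def top_unique powr_le1)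

lemma ereal_mult_left_mono_neg:
  fixes x y :: ereal
  assumes "c < 0" "x \<le> y"
  shows "ereal c * y \<le> ereal c * x"
  using assms by (cases x; cases y) auto

text \<open>This allows the \<open>infsum\<close> of the theorem to be handled by integration over
  counting measures. Finite partial sums give one direction. For the other, a finite total forces
  all values to be finite, and the real-valued version \<open>g\<close> of \<open>f\<close> is then
  absolutely summable.\<close>

lemma infsum_eq_nn_integral:
  fixes f :: "'a \<Rightarrow> ennreal"
  shows "infsum f A = (\<integral>\<^sup>+ x. f x \<partial>count_space A)"
proof (rule antisym)
  have "sum f F \<le> (\<integral>\<^sup>+ x. f x \<partial>count_space A)" if "finite F" "F \<subseteq> A" for F
  proof -
    have "sum f F = (\<integral>\<^sup>+ x. f x \<partial>count_space F)"
      using that by (simp add: nn_integral_count_space_finite)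
    also have "\<dots> \<le> (\<integral>\<^sup>+ x. f x \<partial>count_space A)"
      using that by (auto simp: nn_integral_count_space_indicator indicator_def intro!: nn_integral_mono)
    finally show ?thesis .
  qed
  then show "infsum f A \<le> (\<integral>\<^sup>+ x. f x \<partial>count_space A)"
    by (subst nonneg_infsum_complete) (auto intro!: SUP_least)
  show "(\<integral>\<^sup>+ x. f x \<partial>count_space A) \<le> infsum f A"
  proof (cases "infsum f A = top")
    case False
    have bound: "sum f F \<le> infsum f A" if "finite F" "F \<subseteq> A" for F
      using that by (subst nonneg_infsum_complete) (auto intro!: SUP_upper)
    have fin: "f x \<noteq> top" if "x \<in> A" for x
      using bound[of "{x}"] that False by (auto simp: top_unique)
    define g where "g x = enn2real (f x)" for x
    have g: "ennreal (g x) = f x" "g x \<ge> 0" if "x \<in> A" for x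
      using fin[OF that] by (simp_all add: g_def less_top)
    have sumg: "ennreal (sum g F) = sum f F" if "F \<subseteq> A" for F
      using that g by (subst sum_ennreal[symmetric]) (auto intro!: sum.cong)
    have "g summable_on A"
    proof (rule nonneg_bdd_above_summable_on)
      show "bdd_above (sum g ` {F. F \<subseteq> A \<and> finite F})"
      proof (rule bdd_aboveI2)
        fix F assume F: "F \<in> {F. F \<subseteq> A \<and> finite F}"
        then have "ennreal (sum g F) \<le> ennreal (enn2real (infsum f A))"
          using bound[of F] sumg[of F] False by (simp add: less_top)
        then show "sum g F \<le> enn2real (infsum f A)"
          by (subst (asm) ennreal_le_iff) auto
      qed
    qed (use g in auto)
    then have "(\<lambda>x. norm (g x)) summable_on A"
      by (rule summable_on_cong[THEN iffD1, rotated]) (use g in auto)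
    then have abs: "Infinite_Set_Sum.abs_summable_on g A"
      by (rule abs_summable_equivalent[THEN iffD1])
    have "(\<integral>\<^sup>+ x. f x \<partial>count_space A) = (\<integral>\<^sup>+ x. ennreal (g x) \<partial>count_space A)"
      by (intro nn_integral_cong) (auto simp: g)
    also have "\<dots> = ennreal (infsum g A)"
      using nn_integral_conv_infsetsum[OF abs] g by (simp add: infsetsum_infsum[OF abs])
    also have "\<dots> = (SUP F\<in>{F. finite F \<and> F \<subseteq> A}. ennreal (sum g F))"
      using \<open>g summable_on A\<close> g by (intro infsum_nonneg_is_SUPREMUM_ennreal) auto
    also have "\<dots> = infsum f A"
      by (subst nonneg_infsum_complete) (auto intro!: SUP_cong simp: sumg)
    finally show ?thesis by simp
  qed simp
qed

section \<open>Sibson minimisation over the law of Z\<close>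

lemma sibson_minimisation:
  fixes p :: "'z pmf" and W :: "'z \<Rightarrow> ennreal"
  assumes \<alpha>: "\<alpha> > 0" "\<alpha> \<noteq> 1"
    and W_pos: "\<And>z. z \<in> set_pmf p \<Longrightarrow> W z \<noteq> 0"
    and W_le: "\<And>z. \<alpha> < 1 \<Longrightarrow> z \<in> set_pmf p \<Longrightarrow> W z \<le> 1"
  defines "T \<equiv> \<lambda>Q. \<integral>\<^sup>+ z. ennreal (pmf p z powr \<alpha> * pmf Q z powr (1 - \<alpha>)) * W z \<partial>count_space UNIV"
  defines "D \<equiv> \<lambda>Q. if \<alpha> > 1 \<and> \<not> set_pmf p \<subseteq> set_pmf Q then \<infinity> else ereal (1 / (\<alpha> - 1)) * ln_ext (T Q)"
  defines "R \<equiv> ereal (\<alpha> / (\<alpha> - 1)) *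
    ln_ext (\<integral>\<^sup>+ z. ennreal (pmf p z) * powr_ext (W z) (1 / \<alpha>) \<partial>count_space UNIV)"
  shows "R \<le> D Q" and "\<exists>Q. D Q = R"
proof -
  define S where "S = (\<integral>\<^sup>+ z. ennreal (pmf p z) * powr_ext (W z) (1 / \<alpha>) \<partial>count_space UNIV)"
  define w where "w z = enn2real (W z)" for z
  have w_nonneg: "w z \<ge> 0" for z
    by (simp add: w_def)
  \<comment> \<open>The minimiser before normalisation. Its power \<open>g z powr \<alpha>\<close>
    restores \<open>w z\<close> itself, so \<open>T Q\<close> becomes a Hellinger sum with
    \<open>g\<close> in the first argument, provided \<open>W\<close> is finite on the support of
    \<open>p\<close>.\<close>
  define g where "g z = pmf p z * w z powr (1 / \<alpha>)" for z
  have S_eq: "S = (\<integral>\<^sup>+ z. ennreal (g z) \<partial>count_space UNIV)"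
    if "\<And>z. z \<in> set_pmf p \<Longrightarrow> W z \<noteq> top"
    unfolding S_def
    using that by (intro nn_integral_cong)
      (auto simp: g_def w_def powr_ext_def ennreal_mult set_pmf_iff)
  have T_eq: "T Q = (\<integral>\<^sup>+ z. ennreal (g z powr \<alpha> * pmf Q z powr (1 - \<alpha>)) \<partial>count_space UNIV)"
    if "\<And>z. z \<in> set_pmf p \<Longrightarrow> W z \<noteq> top" for Q
    unfolding T_def
  proof (intro nn_integral_cong)
    fix z
    show "ennreal (pmf p z powr \<alpha> * pmf Q z powr (1 - \<alpha>)) * W z
      = ennreal (g z powr \<alpha> * pmf Q z powr (1 - \<alpha>))"
    proof (cases "z \<in> set_pmf p")
      case True
      then have "W z = ennreal (w z)"
        using that by (simp add: w_def less_top)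
      moreover have "g z powr \<alpha> = pmf p z powr \<alpha> * w z"
        using \<alpha> by (simp add: g_def powr_mult powr_powr w_def)
      ultimately show ?thesis
        using w_nonneg by (simp add: mult_ac flip: ennreal_mult)
    qed (simp add: g_def set_pmf_iff)
  qed
  obtain z0 where z0: "z0 \<in> set_pmf p"
    using set_pmf_not_empty[of p] by blast
  \<comment> \<open>One point of the support of \<open>p\<close> suffices, since
    \<open>powr_ext\<close> vanishes only at 0.\<close>
  have "S \<noteq> 0"
    using z0 W_pos[OF z0]
    by (auto simp: S_def nn_integral_0_iff_AE AE_count_space powr_ext_eq_0_iff set_pmf_iff intro!: exI[of _ z0])
  have "(\<forall>Q. R \<le> D Q) \<and> (\<exists>Q. D Q = R)"
  proof (cases "S = top")
    case True
    \<comment> \<open>For \<alpha> < 1 the bound \<open>W z \<le> 1\<close> makes \<open>S\<close>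
      at most the total mass of \<open>p\<close>.\<close>
    have "\<alpha> > 1"
    proof (rule ccontr)
      assume "\<not> \<alpha> > 1"
      with \<alpha> have "\<alpha> < 1" by simp
      have "S \<le> (\<integral>\<^sup>+ z. ennreal (pmf p z) \<partial>count_space UNIV)"
        unfolding S_def
      proof (intro nn_integral_mono)
        fix z
        show "ennreal (pmf p z) * powr_ext (W z) (1 / \<alpha>) \<le> ennreal (pmf p z)"
          using W_le[OF \<open>\<alpha> < 1\<close>, of z] \<alpha> powr_ext_le_1[of "W z" "1 / \<alpha>"]
            mult_left_mono[of "powr_ext (W z) (1 / \<alpha>)" 1 "ennreal (pmf p z)"]
          by (cases "z \<in> set_pmf p") (auto simp: set_pmf_iff)
      qed
      with True show False
        by (simp add: nn_integral_pmf_UNIV top_unique)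
    qed
    \<comment> \<open>Other \<open>Q\<close> have infinite \<open>D Q\<close> by definition. Either
      a single \<open>W z\<close> is infinite and has positive weight in \<open>T Q\<close>, or all
      are finite and \<alpha> S \<le> T Q + (\<alpha> - 1) forces the claim.\<close>
    have "T Q = top" if sub: "set_pmf p \<subseteq> set_pmf Q" for Q
    proof (cases "\<exists>z\<in>set_pmf p. W z = top")
      case True
      then obtain z where z: "z \<in> set_pmf p" "W z = top" by blast
      then have "top = ennreal (pmf p z powr \<alpha> * pmf Q z powr (1 - \<alpha>)) * W z"
        using sub by (auto simp: ennreal_mult_eq_top_iff set_pmf_iff)
      also have "\<dots> \<le> T Q"
        unfolding T_def by (rule nn_integral_ge_point) simp
      finally show ?thesis by (simp add: top_unique)
    next
      case False
      then have fin: "z \<in> set_pmf p \<Longrightarrow> W z \<noteq> top" for z by blast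
      have "ennreal \<alpha> * (\<integral>\<^sup>+ z. ennreal (g z) \<partial>count_space UNIV)
        \<le> (\<integral>\<^sup>+ z. ennreal (g z powr \<alpha> * pmf Q z powr (1 - \<alpha>)) \<partial>count_space UNIV) + ennreal (\<alpha> - 1)"
        using \<open>\<alpha> > 1\<close> sub
        by (intro nn_integral_powr_mult_pmf_powr_ge) (auto simp: g_def zero_less_mult_iff pmf_positive_iff)
      then show ?thesis
        using \<open>S = top\<close> \<alpha>
        by (simp add: S_eq[OF fin, symmetric] T_eq[OF fin, symmetric] ennreal_mult_top top_unique)
    qed
    then have "D Q = \<infinity>" for Q
      using \<open>\<alpha> > 1\<close> by (auto simp: D_def ln_ext_def)
    moreover have "R = \<infinity>"
      using \<open>\<alpha> > 1\<close> True by (simp add: R_def S_def[symmetric] ln_ext_def)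
    ultimately show ?thesis by simp
  next
    case False
    have fin: "W z \<noteq> top" if "z \<in> set_pmf p" for z
    proof
      assume "W z = top"
      with that have "top = ennreal (pmf p z) * powr_ext (W z) (1 / \<alpha>)"
        by (simp add: powr_ext_def ennreal_mult_top set_pmf_iff)
      also have "\<dots> \<le> S"
        unfolding S_def by (rule nn_integral_ge_point) simp
      finally show False using False by (simp add: top_unique)
    qed
    define s where "s = enn2real S"
    have s: "s > 0" "S = ennreal s"
      using False \<open>S \<noteq> 0\<close> by (auto simp: s_def less_top enn2real_positive_iff zero_less_iff_neq_zero)
    have g_nonneg: "g z \<ge> 0" for z
      by (simp add: g_def)
    have "(\<integral>\<^sup>+ z. ennreal (g z / s) \<partial>count_space UNIV) = S / ennreal s"
      using s(1) g_nonneg S_eq[OF fin]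
      by (simp add: nn_integral_divide flip: divide_ennreal)
    also have "\<dots> = 1"
      using s by (simp add: divide_ennreal)
    finally have int1: "(\<integral>\<^sup>+ z. ennreal (g z / s) \<partial>count_space UNIV) = 1" .
    define Q' where "Q' = embed_pmf (\<lambda>z. g z / s)"
    have pmf_Q': "pmf Q' z = g z / s" for z
      unfolding Q'_def using s(1) g_nonneg int1 by (intro pmf_embed_pmf) auto
    \<comment> \<open>Since \<open>W\<close> is positive and finite on the support of
      \<open>p\<close>, normalisation leaves the support unchanged. Hence \<open>D Q'\<close> avoids
      the infinite branch, and the condition in \<open>D\<close> is the one required by
      \<open>hellinger_sum_ge_1\<close> for \<open>Q'\<close>.\<close>
    have set_Q': "set_pmf Q' = set_pmf p"
      using s(1) W_pos fin
      by (auto simp: set_pmf_iff pmf_Q' g_def w_def enn2real_eq_0_iff)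
    define H where "H Q = (\<integral>\<^sup>+ z. ennreal (pmf Q' z powr \<alpha> * pmf Q z powr (1 - \<alpha>)) \<partial>count_space UNIV)" for Q
    \<comment> \<open>Sibson's identity: the scalar \<open>s\<close> in
      \<open>g z = s * pmf Q' z\<close> comes out of the sum as
      \<open>s powr \<alpha>\<close>.\<close>
    have T_H: "T Q = ennreal (s powr \<alpha>) * H Q" for Q
    proof -
      have "g z = s * pmf Q' z" for z
        using s(1) by (simp add: pmf_Q')
      then have "g z powr \<alpha> * pmf Q z powr (1 - \<alpha>) = s powr \<alpha> * (pmf Q' z powr \<alpha> * pmf Q z powr (1 - \<alpha>))" for z
        using s(1) by (simp add: powr_mult)
      then have "T Q = (\<integral>\<^sup>+ z. ennreal (s powr \<alpha> * (pmf Q' z powr \<alpha> * pmf Q z powr (1 - \<alpha>))) \<partial>count_space UNIV)"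
        by (simp only: T_eq[OF fin])
      also have "\<dots> = (\<integral>\<^sup>+ z. ennreal (s powr \<alpha>) * ennreal (pmf Q' z powr \<alpha> * pmf Q z powr (1 - \<alpha>)) \<partial>count_space UNIV)"
        by (intro nn_integral_cong ennreal_mult) auto
      also have "\<dots> = ennreal (s powr \<alpha>) * H Q"
        unfolding H_def by (rule nn_integral_cmult) simp
      finally show ?thesis .
    qed
    \<comment> \<open>Moving \<alpha> into the logarithm exhibits \<open>R\<close> as the value of
      \<open>D\<close> at \<open>H Q = 1\<close>.\<close>
    have R: "R = ereal (1 / (\<alpha> - 1)) * ln_ext (ennreal (s powr \<alpha>))"
      using s by (simp add: R_def S_def[symmetric] ln_ext_powr) (simp add: ln_ext_def)
    have "H Q' = 1"
      by (simp add: H_def nn_integral_pmf_UNIV flip: powr_add)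
    then have "D Q' = R"
      by (simp add: D_def set_Q' T_H R)
    moreover have "R \<le> D Q" for Q
    \<comment> \<open>The bound on \<open>H Q\<close> changes direction at \<alpha> = 1, and so does
      the sign of 1/(\<alpha> - 1); both cases give the same inequality.\<close>
    proof (cases "\<alpha> > 1")
      case True
      show ?thesis
      proof (cases "set_pmf p \<subseteq> set_pmf Q")
        case sub: True
        have "1 \<le> H Q"
          unfolding H_def using True sub by (intro hellinger_sum_ge_1) (simp_all add: set_Q')
        then have "ennreal (s powr \<alpha>) * 1 \<le> T Q"
          unfolding T_H by (intro mult_left_mono) auto
        then show ?thesis
          using True sub by (auto simp: D_def R intro!: ereal_mult_left_mono ln_ext_mono)
      qed (use True in \<open>simp add: D_def\<close>)
    next
      case False
      with \<alpha> have "\<alpha> < 1" by simp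
      have "H Q \<le> 1"
        unfolding H_def using \<alpha> \<open>\<alpha> < 1\<close> by (intro hellinger_sum_le_1)
      then have "T Q \<le> ennreal (s powr \<alpha>) * 1"
        unfolding T_H by (intro mult_left_mono) auto
      then show ?thesis
        using \<open>\<alpha> < 1\<close> unfolding R D_def by (auto intro!: ereal_mult_left_mono_neg ln_ext_mono)
    qed
    ultimately show ?thesis by blast
  qed
  then show "R \<le> D Q" and "\<exists>Q. D Q = R" by auto
qed

section \<open>Conditional laws given Z and the divergence of a candidate law\<close>

lemma pmf_eq_marginal_Z_mult_cond_XY:
  "pmf P (x, y, z) = pmf (marginal_Z P) z * pmf (cond_XY P z) (x, y)"
proof -
  have marg: "pmf (marginal_Z P) z = measure P {(x, y, z'). z' = z}"
    unfolding marginal_Z_def pmf_map by (intro arg_cong[of _ _ "measure P"]) auto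
  show ?thesis
  proof (cases "set_pmf P \<inter> {(x, y, z'). z' = z} = {}")
    \<comment> \<open>Here z has probability 0 and \<open>cond_pmf\<close> is unspecified, but both
      sides vanish.\<close>
    case True
    then have "pmf (marginal_Z P) z = 0"
      by (simp add: marg measure_pmf_zero_iff)
    moreover have "pmf P (x, y, z) = 0"
      using True by (auto simp: set_pmf_iff)
    ultimately show ?thesis by simp
  next
    case False
    let ?C = "cond_pmf P {(x, y, z'). z' = z}"
    have "pmf (cond_XY P z) (x, y) = measure ?C ((\<lambda>(x, y, z'). (x, y)) -` {(x, y)})"
      unfolding cond_XY_def pmf_map ..
    \<comment> \<open>Under \<open>?C\<close> the third coordinate is almost surely z, so the fibre
      over (x, y) reduces to one point.\<close>
    also have "\<dots> = measure ?C {(x, y, z)}"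
      using False by (intro measure_pmf.finite_measure_eq_AE) (auto simp: AE_measure_pmf_iff set_cond_pmf)
    also have "\<dots> = pmf P (x, y, z) / pmf (marginal_Z P) z"
      using False by (simp add: measure_pmf_single pmf_cond marg)
    finally show ?thesis
      using False by (auto simp: marg measure_pmf_zero_iff)
  qed
qed

lemma pmf_cond_indep_law:
  "pmf (cond_indep_law P Q) (x, y, z) = pmf Q z * (pmf (cond_X P z) x * pmf (cond_Y P z) y)"
proof -
  \<comment> \<open>Only z' = z can produce the triple, so the conditionals may be taken at the
    fixed z and leave the integral over \<open>Q\<close>.\<close>
  have inner: "pmf (map_pmf (\<lambda>(x, y). (x, y, z')) (pair_pmf (cond_X P z') (cond_Y P z'))) (x, y, z)
      = indicator {z} z' * (pmf (cond_X P z) x * pmf (cond_Y P z) y)" for z'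
  proof -
    have "(\<lambda>(x, y). (x, y, z')) -` {(x, y, z)} = (if z' = z then {(x, y)} else {})"
      by auto
    then show ?thesis
      by (auto simp: pmf_map measure_pmf_single pmf_pair)
  qed
  show ?thesis
    unfolding cond_indep_law_def pmf_bind inner
    by (simp add: measure_pmf_single)
qed

lemma set_cond_XY_subset: "set_pmf (cond_XY P z) \<subseteq> set_pmf (cond_X P z) \<times> set_pmf (cond_Y P z)"
  by (force simp: cond_X_def cond_Y_def)

lemma absolutely_continuous_pmf_iff:
  "absolutely_continuous (measure_pmf Q) (measure_pmf P) \<longleftrightarrow> set_pmf P \<subseteq> set_pmf Q"
proof
  assume "absolutely_continuous (measure_pmf Q) (measure_pmf P)"
  moreover have "- set_pmf Q \<in> null_sets (measure_pmf Q)"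
    by (rule in_null_sets_measure_pmfI) auto
  ultimately have "- set_pmf Q \<in> null_sets (measure_pmf P)"
    by (auto simp: absolutely_continuous_def)
  then show "set_pmf P \<subseteq> set_pmf Q"
    by (auto simp: null_sets_def measure_pmf.emeasure_eq_measure measure_pmf_zero_iff)
next
  assume "set_pmf P \<subseteq> set_pmf Q"
  then show "absolutely_continuous (measure_pmf Q) (measure_pmf P)"
    by (auto simp: absolutely_continuous_def null_sets_def measure_pmf.emeasure_eq_measure measure_pmf_zero_iff)
qed

text \<open>Given z, the joint law of X and Y is carried by the product of the supports of its
  marginals. Absolute continuity can therefore fail only through the Z coordinate.\<close>

lemma set_pmf_subset_cond_indep_law_iff:
  "set_pmf P \<subseteq> set_pmf (cond_indep_law P Q) \<longleftrightarrow> set_pmf (marginal_Z P) \<subseteq> set_pmf Q"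
proof
  assume sub: "set_pmf P \<subseteq> set_pmf (cond_indep_law P Q)"
  show "set_pmf (marginal_Z P) \<subseteq> set_pmf Q"
  proof
    fix z assume "z \<in> set_pmf (marginal_Z P)"
    then obtain x y where "(x, y, z) \<in> set_pmf P"
      by (auto simp: marginal_Z_def)
    with sub have "(x, y, z) \<in> set_pmf (cond_indep_law P Q)" by auto
    then show "z \<in> set_pmf Q"
      by (simp add: set_pmf_iff pmf_cond_indep_law)
  qed
next
  assume sub: "set_pmf (marginal_Z P) \<subseteq> set_pmf Q"
  show "set_pmf P \<subseteq> set_pmf (cond_indep_law P Q)"
  proof
    fix v assume v: "v \<in> set_pmf P"
    obtain x y z where [simp]: "v = (x, y, z)" by (cases v)
    from v have "z \<in> set_pmf (marginal_Z P)" "(x, y) \<in> set_pmf (cond_XY P z)"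
      by (auto simp: set_pmf_iff pmf_eq_marginal_Z_mult_cond_XY)
    then show "v \<in> set_pmf (cond_indep_law P Q)"
      using sub set_cond_XY_subset[of P z]
      by (auto simp: set_pmf_iff pmf_cond_indep_law)
  qed
qed

text \<open>The exponential of \<alpha> - 1 times the Renyi divergence of the conditional joint law
  from the product of its marginals. For \<alpha> > 1 it may be infinite, hence the type
  \<open>ennreal\<close>.\<close>

definition cond_hellinger_sum :: "real \<Rightarrow> ('x \<times> 'y \<times> 'z) pmf \<Rightarrow> 'z \<Rightarrow> ennreal" where
  "cond_hellinger_sum \<alpha> P z = (\<integral>\<^sup>+ (x, y).
     ennreal (pmf (cond_XY P z) (x, y) powr \<alpha> *
       (pmf (cond_X P z) x * pmf (cond_Y P z) y) powr (1 - \<alpha>)) \<partial>count_space UNIV)"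

lemma cond_hellinger_sum_neq_0: "cond_hellinger_sum \<alpha> P z \<noteq> 0"
proof -
  obtain x y where xy: "(x, y) \<in> set_pmf (cond_XY P z)"
    using set_pmf_not_empty[of "cond_XY P z"] by (metis ex_in_conv surj_pair)
  with set_cond_XY_subset[of P z] show ?thesis
    by (auto simp: cond_hellinger_sum_def nn_integral_0_iff_AE AE_count_space set_pmf_iff
        pmf_nonneg less_le split: prod.split intro!: exI[of _ x] exI[of _ y])
qed

lemma cond_hellinger_sum_le_1: "0 < \<alpha> \<Longrightarrow> \<alpha> < 1 \<Longrightarrow> cond_hellinger_sum \<alpha> P z \<le> 1"
  using hellinger_sum_le_1[of \<alpha> "cond_XY P z" "pair_pmf (cond_X P z) (cond_Y P z)"]
  by (simp add: cond_hellinger_sum_def pmf_pair case_prod_beta' flip: pmf_pair)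

text \<open>Both densities split into a factor in z and a conditional factor, and so do their
  powers. Summing over (x, y) first leaves exactly the function \<open>D\<close> of
  \<open>sibson_minimisation\<close>.\<close>

lemma renyi_divergence_cond_indep_law:
  "renyi_divergence_pmf \<alpha> P (cond_indep_law P Q) =
    (if \<alpha> > 1 \<and> \<not> set_pmf (marginal_Z P) \<subseteq> set_pmf Q then \<infinity>
     else ereal (1 / (\<alpha> - 1)) * ln_ext (\<integral>\<^sup>+ z. ennreal (pmf (marginal_Z P) z powr \<alpha> * pmf Q z powr (1 - \<alpha>))
       * cond_hellinger_sum \<alpha> P z \<partial>count_space UNIV))"
proof -
  let ?L = "cond_indep_law P Q"
  let ?f = "\<lambda>v. ennreal (pmf P v powr \<alpha> * pmf ?L v powr (1 - \<alpha>))"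
  \<comment> \<open>Triples nest to the right; regrouping them as ((x, y), z) makes z the second
    component, which can be integrated last.\<close>
  have bij: "bij_betw (\<lambda>((x, y), z). (x, y, z)) UNIV (UNIV :: ('a \<times> 'b \<times> 'c) set)"
    by (rule bij_betw_byWitness[where f' = "\<lambda>(x, y, z). ((x, y), z)"]) auto
  have "(\<integral>\<^sup>+ v. ?f v \<partial>count_space UNIV)
      = (\<integral>\<^sup>+ v. ?f ((\<lambda>((x, y), z). (x, y, z)) v) \<partial>count_space UNIV)"
    by (rule nn_integral_bij_count_space[OF bij, symmetric])
  also have "\<dots> = (\<integral>\<^sup>+ z. \<integral>\<^sup>+ xy. ?f ((\<lambda>((x, y), z). (x, y, z)) (xy, z)) \<partial>count_space UNIV \<partial>count_space UNIV)"
    by (rule nn_integral_snd_count_space[symmetric])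
  also have "\<dots> = (\<integral>\<^sup>+ z. ennreal (pmf (marginal_Z P) z powr \<alpha> * pmf Q z powr (1 - \<alpha>))
       * cond_hellinger_sum \<alpha> P z \<partial>count_space UNIV)"
    unfolding cond_hellinger_sum_def
    by (intro nn_integral_cong, subst nn_integral_cmult[symmetric])
      (auto simp: pmf_eq_marginal_Z_mult_cond_XY[of P] pmf_cond_indep_law powr_mult mult_ac
        intro!: nn_integral_cong simp flip: ennreal_mult)
  finally show ?thesis
    by (simp add: renyi_divergence_pmf_def renyi_divergence_def absolutely_continuous_pmf_iff
        set_pmf_subset_cond_indep_law_iff flip: measure_pmf_eq_density)
qed

theorem theorem2:
  fixes \<alpha> :: real and P :: "('x \<times> 'y \<times> 'z) pmf"
  assumes "\<alpha> > 0" and "\<alpha> \<noteq> 1"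
  shows "(\<exists>Q :: 'z pmf. renyi_divergence_pmf \<alpha> P (cond_indep_law P Q) = renyi_cond_mutual_info \<alpha> P)
    \<and> renyi_cond_mutual_info \<alpha> P =
        ereal (\<alpha> / (\<alpha> - 1)) *
        ln_ext (\<Sum>\<^sub>\<infinity>z\<in>set_pmf (marginal_Z P).
          ennreal (pmf (marginal_Z P) z) *
          powr_ext (\<Sum>\<^sub>\<infinity>(x, y)\<in>UNIV.
              ennreal (pmf (cond_XY P z) (x, y) powr \<alpha> *
                       (pmf (cond_X P z) x * pmf (cond_Y P z) y) powr (1 - \<alpha>)))
            (1 / \<alpha>))"
    (is "_ \<and> _ = ?R")
proof -
  let ?D = "\<lambda>Q. renyi_divergence_pmf \<alpha> P (cond_indep_law P Q)"
  \<comment> \<open>Outside the support the weight of z is 0, so the sum extends to all z.\<close>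
  have "(\<Sum>\<^sub>\<infinity>z\<in>set_pmf (marginal_Z P). ennreal (pmf (marginal_Z P) z) *
      powr_ext (cond_hellinger_sum \<alpha> P z) (1 / \<alpha>))
    = (\<integral>\<^sup>+ z. ennreal (pmf (marginal_Z P) z) *
      powr_ext (cond_hellinger_sum \<alpha> P z) (1 / \<alpha>) \<partial>count_space UNIV)"
    unfolding infsum_eq_nn_integral
    by (subst nn_integral_count_space_indicator)
      (auto simp: indicator_def set_pmf_iff intro!: nn_integral_cong)
  then have min: "?R \<le> ?D Q" "\<exists>Q. ?D Q = ?R" for Q
    using sibson_minimisation[OF assms, of "marginal_Z P" "cond_hellinger_sum \<alpha> P"]
      cond_hellinger_sum_neq_0[of \<alpha> P] cond_hellinger_sum_le_1[OF assms(1), of P]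
    by (simp_all add: renyi_divergence_cond_indep_law infsum_eq_nn_integral[of _ UNIV]
        flip: cond_hellinger_sum_def)
  then obtain Q where Q: "?D Q = ?R" by blast
  have "renyi_cond_mutual_info \<alpha> P = ?R"
    unfolding renyi_cond_mutual_info_def
    using min(1) INF_lower[of Q UNIV ?D] by (intro antisym INF_greatest) (simp_all add: Q)
  with Q show ?thesis by auto
qed

end
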